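(* Let $k\geq 3$ and let $\mathcal{G}$ be a $k$-uniform supertree of order $n$ with $m(\mathcal{G})\geq 3$ edges such that $\mathcal{G}\ncong \mathcal{S}^{\ast}(n, k)$. Then $\rho(\mathcal{G})\leq\rho\big(\mathcal{S}(n, k; \tfrac{n-1}{k-1}-2, 1)\big)$, with equality if and only if $\mathcal{G}\cong \mathcal{S}(n, k; \frac{n-1}{k-1}-2, 1)$.
   Context: A hypergraph $\mathcal{G}=(V,E)$ has a nonempty finite vertex set $V$ and a set $E$ of distinct edges, each a subset of $V$ with at least two vertices; $n=|V|$ is the order, $m(\mathcal{G})=|E|$. It is $k$-uniform if all edges have $k$ vertices. Its adjacency matrix $\mathcal{A}_{\mathcal{G}}$ has $(\mathcal{A}_{\mathcal{G}})_{ij}=\sum_{e\in E,\ i,j\in e}\frac{1}{|e|-1}$ for $i\neq j$ and $0$ on the diagonal; $\rho(\mathcal{G})$ is the largest modulus of an eigenvalue of $\mathcal{A}_{\mathcal{G}}$. A supertree is a connected hypergraph containing no (Berge) cycle $v_1e_1v_2\cdots v_qe_qv_1$ ($q\ge2$, distinct vertices, distinct edges, $v_i,v_{i+1}\in e_i$ indices mod $q$); any two edges of a supertree share at most one vertex and a $k$-uniform supertree of order $n$ has $\frac{n-1}{k-1}$ edges. A pendant edge is an edge in which at most one vertex has degree greater than one (degree = number of edges containing the vertex). The superstar $\mathcal{S}^{\ast}(n,k)$ is the $k$-uniform supertree of order $n$ whose edges all contain a common vertex. For $l_1,l_2\ge1$, the double hyperstar $\mathcal{S}(n,k;l_1,l_2)$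 is the $k$-uniform supertree of order $n$ obtained from an edge $e$ with two distinct vertices $u_1,u_2\in e$ by attaching $l_1$ pendant edges at $u_1$ and $l_2$ pendant edges at $u_2$ (each attached edge meets the rest only in its attachment vertex). *)

theory Defs
  imports Complex_Main
begin

text \<open>A hypergraph is given by a vertex set V and an edge set E (a set of subsets of V).\<close>

definition hypergraph :: "'a set \<Rightarrow> 'a set set \<Rightarrow> bool" where
  "hypergraph V E \<longleftrightarrow> finite V \<and> V \<noteq> {} \<and> (\<forall>e\<in>E. e \<subseteq> V \<and> 2 \<le> card e)"

definition k_uniform :: "nat \<Rightarrow> 'a set set \<Rightarrow> bool" where
  "k_uniform k E \<longleftrightarrow> (\<forall>e\<in>E. card e = k)"

text \<open>Adjacency matrix entries (as a function on vertices).\<close>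

definition adj :: "'a set set \<Rightarrow> 'a \<Rightarrow> 'a \<Rightarrow> real" where
  "adj E i j = (if i = j then 0
     else (\<Sum>e\<in>{e\<in>E. i \<in> e \<and> j \<in> e}. 1 / (real (card e) - 1)))"

definition is_eigenvalue :: "'a set \<Rightarrow> 'a set set \<Rightarrow> complex \<Rightarrow> bool" where
  "is_eigenvalue V E \<mu> \<longleftrightarrow>
     (\<exists>x :: 'a \<Rightarrow> complex. (\<exists>v\<in>V. x v \<noteq> 0) \<and>
        (\<forall>i\<in>V. (\<Sum>j\<in>V. complex_of_real (adj E i j) * x j) = \<mu> * x i))"

definition spectral_radius :: "'a set \<Rightarrow> 'a set set \<Rightarrow> real" where
  "spectral_radius V E = Max (cmod ` {\<mu>. is_eigenvalue V E \<mu>})"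

text \<open>Connectivity and Berge cycles.\<close>

definition hg_connected :: "'a set \<Rightarrow> 'a set set \<Rightarrow> bool" where
  "hg_connected V E \<longleftrightarrow>
     (\<forall>x\<in>V. \<forall>y\<in>V. (x, y) \<in> {(u, v). \<exists>e\<in>E. u \<in> e \<and> v \<in> e}\<^sup>*)"

definition has_berge_cycle :: "'a set set \<Rightarrow> bool" where
  "has_berge_cycle E \<longleftrightarrow>
     (\<exists>vs es. length vs = length es \<and> 2 \<le> length vs \<and> distinct vs \<and> distinct es \<and>
        set es \<subseteq> E \<and>
        (\<forall>i < length vs. vs ! i \<in> es ! i \<and> vs ! ((i + 1) mod length vs) \<in> es ! i))"

definition supertree :: "'a set \<Rightarrow> 'a set set \<Rightarrow> bool" where
  "supertree V E \<longleftrightarrow> hypergraph V E \<and> hg_connected V E \<and> \<not> has_berge_cycle E"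

definition hg_iso :: "'a set \<Rightarrow> 'a set set \<Rightarrow> 'b set \<Rightarrow> 'b set set \<Rightarrow> bool" where
  "hg_iso V E V' E' \<longleftrightarrow> (\<exists>f. bij_betw f V V' \<and> (\<lambda>e. f ` e) ` E = E')"

text \<open>Superstar S*(n,k): vertices 0..n-1, all edges contain vertex 0.\<close>

definition superstar_V :: "nat \<Rightarrow> nat set" where
  "superstar_V n = {..<n}"

definition superstar_E :: "nat \<Rightarrow> nat \<Rightarrow> nat set set" where
  "superstar_E n k = (\<lambda>i. insert 0 {1 + i * (k - 1) ..< 1 + (i + 1) * (k - 1)}) ` {..<(n - 1) div (k - 1)}"

text \<open>Double hyperstar S(n,k;l1,l2) with n = k + (l1+l2)(k-1): central edge {0..k-1},
  u1 = 0, u2 = 1, l1 pendant edges at 0 and l2 pendant edges at 1.\<close>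

definition dstar_V :: "nat \<Rightarrow> nat \<Rightarrow> nat \<Rightarrow> nat set" where
  "dstar_V k l1 l2 = {..<k + (l1 + l2) * (k - 1)}"

definition dstar_E :: "nat \<Rightarrow> nat \<Rightarrow> nat \<Rightarrow> nat set set" where
  "dstar_E k l1 l2 =
     insert {..<k}
       ((\<lambda>i. insert 0 {k + i * (k - 1) ..< k + (i + 1) * (k - 1)}) ` {..<l1} \<union>
        (\<lambda>i. insert 1 {k + i * (k - 1) ..< k + (i + 1) * (k - 1)}) ` {l1..<l1 + l2})"

end

theory Submission
  imports Defs "HOL-Analysis.Function_Topology" "Jordan_Normal_Form.Char_Poly"
begin

text \<open>Let \<open>x\<close> be the Perron vector of the supertree and \<open>u\<close> a vertex where it is largest. Rooted at
  \<open>u\<close>, every edge \<open>e\<close> consists of a parent \<open>p e\<close> and a set of children, and the sets of children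
  partition \<open>V - {u}\<close>. As the supertree is not a superstar, some edge \<open>e0\<close> has a parent \<open>v \<noteq> u\<close> lying
  in an edge that contains \<open>u\<close>. Regrafting all edges other than \<open>e0\<close> to \<open>u\<close> in one go produces
  exactly the double hyperstar, and since \<open>x u\<close> is maximal it does not decrease the quadratic form
  at \<open>x\<close>; the Rayleigh principle gives the inequality. In case of equality \<open>x\<close> is also an eigenvector
  of the double hyperstar, and comparing the eigenvalue equations at \<open>u\<close> shows that no edge was moved.\<close>

section \<open>The Rayleigh principle for the adjacency matrix\<close>

definition quad_form :: "'a set \<Rightarrow> ('a \<Rightarrow> 'a \<Rightarrow> real) \<Rightarrow> ('a \<Rightarrow> real) \<Rightarrow> real" where
  "quad_form V a x = (\<Sum>i\<in>V. \<Sum>j\<in>V. a i j * x i * x j)"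

lemma quad_form_cong:
  "(\<And>i. i \<in> V \<Longrightarrow> x i = y i) \<Longrightarrow> quad_form V a x = quad_form V a y"
  unfolding quad_form_def by (intro sum.cong refl) auto

lemma quad_form_altdef: "quad_form V a x = (\<Sum>i\<in>V. x i * (\<Sum>j\<in>V. a i j * x j))"
  unfolding quad_form_def sum_distrib_left by (intro sum.cong refl) (simp add: mult_ac)

lemma quad_form_scale: "quad_form V a (\<lambda>i. c * x i) = c\<^sup>2 * quad_form V a x"
  unfolding quad_form_def sum_distrib_left
  by (intro sum.cong refl) (simp add: power2_eq_square mult_ac)

text \<open>Compactness of the unit sphere. Vectors are functions on the whole type, so the sphere
  is cut out of a product of intervals \<open>{-1..1}\<close> on \<open>V\<close> and
  \<open>{0}\<close> elsewhere, which is compact by Tychonoff. Homogeneity of degree two then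
  carries the bound from unit vectors to all \<open>y\<close>.\<close>

lemma quad_form_attains_max:
  fixes V :: "'a set"
  assumes fin: "finite V" and ne: "V \<noteq> {}"
  obtains x where "(\<Sum>i\<in>V. (x i)\<^sup>2) = 1"
    and "\<And>y. quad_form V a y \<le> quad_form V a x * (\<Sum>i\<in>V. (y i)\<^sup>2)"
proof -
  define B :: "'a \<Rightarrow> real set" where "B = (\<lambda>i. if i \<in> V then {-1..1} else {0})"
  define K where "K = PiE UNIV B \<inter> {x. (\<Sum>i\<in>V. (x i)\<^sup>2) = 1}"
  have "compactin (product_topology (\<lambda>i. euclidean) UNIV) (PiE UNIV B)"
    by (subst compactin_PiE) (auto simp: B_def)
  hence cP: "compact (PiE UNIV B)"
    by (simp add: euclidean_product_topology)
  have cn: "continuous_on UNIV (\<lambda>x. \<Sum>i\<in>V. (x i)\<^sup>2 :: real)"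
    by (intro continuous_intros continuous_on_product_coordinates)
  have "closed {x. (\<Sum>i\<in>V. (x i)\<^sup>2) = (1::real)}"
    by (rule closed_Collect_eq[OF cn continuous_on_const])
  hence cK: "compact K" unfolding K_def by (rule compact_Int_closed[OF cP])
  have cq: "continuous_on K (quad_form V a)"
    unfolding quad_form_def
    by (rule continuous_on_subset[of UNIV])
       (intro continuous_intros continuous_on_product_coordinates, simp)
  have inK: "(\<lambda>i. if i \<in> V then y i else 0) \<in> K" if "(\<Sum>i\<in>V. (y i)\<^sup>2) = 1" for y
  proof -
    have "\<bar>y i\<bar> \<le> 1" if "i \<in> V" for i
    proof -
      have "(y i)\<^sup>2 \<le> (\<Sum>i\<in>V. (y i)\<^sup>2)"
        using fin that by (intro member_le_sum) auto
      thus ?thesis using \<open>_ = 1\<close> by (simp add: abs_square_le_1)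
    qed
    thus ?thesis using that
      by (auto simp: K_def B_def PiE_def Pi_def abs_le_iff minus_le_iff)
  qed
  obtain v where v: "v \<in> V" using ne by auto
  have "K \<noteq> {}"
    using inK[of "\<lambda>i. if i = v then 1 else 0"] fin v by (auto simp: if_distrib[of "\<lambda>t. t^2"] cong: if_cong)
  from continuous_attains_sup[OF cK this cq] obtain x where
    x: "x \<in> K" "\<And>y. y \<in> K \<Longrightarrow> quad_form V a y \<le> quad_form V a x" by auto
  show thesis
  proof
    show "(\<Sum>i\<in>V. (x i)\<^sup>2) = 1" using x by (simp add: K_def)
    fix y :: "'a \<Rightarrow> real"
    define N where "N = (\<Sum>i\<in>V. (y i)\<^sup>2)"
    have "N \<ge> 0" unfolding N_def by (intro sum_nonneg) auto
    show "quad_form V a y \<le> quad_form V a x * (\<Sum>i\<in>V. (y i)\<^sup>2)"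
    proof (cases "N = 0")
      case True
      hence "\<forall>i\<in>V. y i = 0" using fin by (simp add: N_def sum_nonneg_eq_0_iff)
      hence "quad_form V a y = 0" by (simp add: quad_form_def)
      thus ?thesis using True by (simp add: N_def)
    next
      case False
      with \<open>N \<ge> 0\<close> have N: "N > 0" by simp
      define z where "z = (\<lambda>i. 1 / sqrt N * y i)"
      have "(\<Sum>i\<in>V. (z i)\<^sup>2) = (1 / sqrt N)\<^sup>2 * N"
        unfolding z_def N_def sum_distrib_left power_mult_distrib ..
      hence "(\<Sum>i\<in>V. (z i)\<^sup>2) = 1" using N by (simp add: power_divide)
      from x(2)[OF inK[OF this]]
      have "quad_form V a z \<le> quad_form V a x"
        by (subst quad_form_cong[where y = "\<lambda>i. if i \<in> V then z i else 0"]) auto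
      hence "(1 / sqrt N)\<^sup>2 * quad_form V a y \<le> quad_form V a x"
        unfolding z_def quad_form_scale .
      thus ?thesis using N by (simp add: power_divide field_simps N_def)
    qed
  qed
qed

lemma quad_form_add:
  assumes sym: "\<And>i j. a i j = a j i"
  shows "quad_form V a (\<lambda>i. x i + t * d i)
    = quad_form V a x + 2 * t * (\<Sum>i\<in>V. d i * (\<Sum>j\<in>V. a i j * x j)) + t\<^sup>2 * quad_form V a d"
proof -
  have 1: "(\<Sum>i\<in>V. \<Sum>j\<in>V. a i j * x i * d j) = (\<Sum>i\<in>V. \<Sum>j\<in>V. a i j * d i * x j)"
    by (subst sum.swap) (intro sum.cong refl, subst sym, simp add: mult_ac)
  have "quad_form V a (\<lambda>i. x i + t * d i)
    = (\<Sum>i\<in>V. \<Sum>j\<in>V. a i j * x i * x j + t * (a i j * x i * d j) + t * (a i j * d i * x j)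
         + t\<^sup>2 * (a i j * d i * d j))"
    unfolding quad_form_def by (intro sum.cong refl) (simp add: algebra_simps power2_eq_square)
  also have "\<dots> = quad_form V a x + t * (\<Sum>i\<in>V. \<Sum>j\<in>V. a i j * x i * d j)
      + t * (\<Sum>i\<in>V. \<Sum>j\<in>V. a i j * d i * x j) + t\<^sup>2 * quad_form V a d"
    by (simp add: sum.distrib sum_distrib_left quad_form_def)
  also have "\<dots> = quad_form V a x + 2 * t * (\<Sum>i\<in>V. \<Sum>j\<in>V. a i j * d i * x j) + t\<^sup>2 * quad_form V a d"
    by (simp add: 1)
  also have "(\<Sum>i\<in>V. \<Sum>j\<in>V. a i j * d i * x j) = (\<Sum>i\<in>V. d i * (\<Sum>j\<in>V. a i j * x j))"
    unfolding sum_distrib_left by (intro sum.cong refl) (simp add: mult_ac)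
  finally show ?thesis .
qed

text \<open>First variation in the direction of the residual \<open>d\<close> of the eigenvalue
  equation: \<open>bound\<close> at \<open>x + t * d\<close> becomes
  \<open>2 * t * R \<le> t\<^sup>2 * c\<close> with \<open>R\<close> the squared norm of
  \<open>d\<close>, and a small positive \<open>t\<close> forces \<open>R = 0\<close>.\<close>

lemma quad_form_max_eigenvector:
  assumes fin: "finite V" and sym: "\<And>i j. a i j = a j i"
    and bound: "\<And>y. quad_form V a y \<le> l * (\<Sum>i\<in>V. (y i)\<^sup>2)"
    and max: "quad_form V a x = l * (\<Sum>i\<in>V. (x i)\<^sup>2)"
    and i: "i \<in> V"
  shows "(\<Sum>j\<in>V. a i j * x j) = l * x i"
proof -
  define d where "d = (\<lambda>i. (\<Sum>j\<in>V. a i j * x j) - l * x i)"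
  define R where "R = (\<Sum>i\<in>V. (d i)\<^sup>2)"
  define c where "c = l * R - quad_form V a d"
  have "R \<ge> 0" unfolding R_def by (intro sum_nonneg) auto
  have "c \<ge> 0" using bound[of d] by (simp add: c_def R_def)
  define X where "X = (\<Sum>i\<in>V. d i * x i)"
  have Ax: "(\<Sum>i\<in>V. d i * (\<Sum>j\<in>V. a i j * x j)) = R + l * X"
  proof -
    have "(\<Sum>j\<in>V. a i j * x j) = d i + l * x i" for i by (simp add: d_def)
    thus ?thesis
      by (simp add: R_def X_def sum_distrib_left sum.distrib power2_eq_square algebra_simps)
  qed
  have key: "2 * t * R \<le> t\<^sup>2 * c" for t
  proof -
    have "(\<Sum>i\<in>V. (x i + t * d i)\<^sup>2) = (\<Sum>i\<in>V. (x i)\<^sup>2 + 2 * t * (d i * x i) + t\<^sup>2 * (d i)\<^sup>2)"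
      by (intro sum.cong refl) (simp add: power2_eq_square algebra_simps)
    also have "\<dots> = (\<Sum>i\<in>V. (x i)\<^sup>2) + 2 * t * X + t\<^sup>2 * R"
      by (simp add: sum.distrib sum_distrib_left X_def R_def)
    finally have n: "(\<Sum>i\<in>V. (x i + t * d i)\<^sup>2) = (\<Sum>i\<in>V. (x i)\<^sup>2) + 2 * t * X + t\<^sup>2 * R" .
    show ?thesis
      using bound[of "\<lambda>i. x i + t * d i"]
      unfolding n quad_form_add[OF sym] Ax max c_def by (simp add: algebra_simps)
  qed
  have "R = 0"
  proof (rule ccontr)
    assume "R \<noteq> 0"
    with \<open>R \<ge> 0\<close> have R: "R > 0" by simp
    \<comment> \<open>Any positive \<open>t\<close> with \<open>t * c < 2 * R\<close> would do; the
      summand 1 keeps the denominator positive when \<open>c = 0\<close>.\<close>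
    define t where "t = R / (c + 1)"
    have t: "t > 0" "t * (c + 1) = R" using R \<open>c \<ge> 0\<close> by (auto simp: t_def)
    have "t * (2 * R) \<le> t * (t * c)" using key[of t] by (simp add: power2_eq_square mult_ac)
    hence "2 * R \<le> t * c" using t(1) by simp
    thus False using t R by (simp add: distrib_left)
  qed
  hence "d i = 0" using fin i by (simp add: R_def sum_nonneg_eq_0_iff)
  thus ?thesis by (simp add: d_def)
qed

text \<open>\<open>spectral_radius\<close> is a \<open>Max\<close>, so finiteness of the spectrum
  must be known. An enumeration of \<open>V\<close> turns the adjacency function into a matrix,
  whose characteristic polynomial has finitely many roots.\<close>

lemma finite_eigenvalues:
  assumes fin: "finite V"
  shows "finite {\<mu>. is_eigenvalue V E \<mu>}"
proof -
  define n where "n = card V"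
  obtain f where f: "bij_betw f {0..<n} V"
    using ex_bij_betw_nat_finite[OF fin] unfolding n_def by blast
  define M where "M = mat n n (\<lambda>(i, j). complex_of_real (adj E (f i) (f j)))"
  have M: "M \<in> carrier_mat n n" by (simp add: M_def)
  have "{\<mu>. is_eigenvalue V E \<mu>} \<subseteq> {\<mu>. poly (char_poly M) \<mu> = 0}"
  proof safe
    fix \<mu> assume "is_eigenvalue V E \<mu>"
    then obtain x :: "'a \<Rightarrow> complex" and v where v: "v \<in> V" "x v \<noteq> 0"
      and x: "\<And>i. i \<in> V \<Longrightarrow> (\<Sum>j\<in>V. complex_of_real (adj E i j) * x j) = \<mu> * x i"
      unfolding is_eigenvalue_def by blast
    define w where "w = vec n (\<lambda>i. x (f i))"
    obtain k where k: "k < n" "f k = v" using f v(1) by (auto simp: bij_betw_def)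
    have "w \<noteq> 0\<^sub>v n"
    proof
      assume "w = 0\<^sub>v n"
      hence "w $ k = 0\<^sub>v n $ k" by simp
      thus False using k v by (simp add: w_def)
    qed
    moreover have "M *\<^sub>v w = \<mu> \<cdot>\<^sub>v w"
    proof (rule eq_vecI)
      fix i assume "i < dim_vec (\<mu> \<cdot>\<^sub>v w)"
      hence i: "i < n" by (simp add: w_def)
      have "(M *\<^sub>v w) $ i = (\<Sum>j\<in>{0..<n}. complex_of_real (adj E (f i) (f j)) * x (f j))"
        using i by (simp add: M_def w_def scalar_prod_def)
      also have "\<dots> = (\<Sum>j\<in>V. complex_of_real (adj E (f i) j) * x j)"
        by (rule sum.reindex_bij_betw[OF f])
      also have "\<dots> = \<mu> * x (f i)" using f i by (intro x) (auto simp: bij_betw_def)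
      finally show "(M *\<^sub>v w) $ i = (\<mu> \<cdot>\<^sub>v w) $ i" using i by (simp add: w_def)
    qed (simp add: M_def w_def)
    ultimately have "eigenvalue M \<mu>"
      unfolding eigenvalue_def eigenvector_def by (intro exI[of _ w]) (simp add: M_def w_def)
    thus "poly (char_poly M) \<mu> = 0" using eigenvalue_root_char_poly[OF M] by simp
  qed
  moreover have "char_poly M \<noteq> 0" using degree_monic_char_poly[OF M] by auto
  ultimately show ?thesis using poly_roots_finite finite_subset by blast
qed

section \<open>The spectral radius as the maximum of the quadratic form\<close>

lemma adj_commute: "adj E i j = adj E j i"
  unfolding adj_def by (simp add: conj_commute eq_commute)

lemma adj_nonneg:
  assumes "hypergraph V E"
  shows "adj E i j \<ge> 0"
proof -
  have "1 / (real (card e) - 1) \<ge> 0" if "e \<in> E" for e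
    using assms that by (auto simp: hypergraph_def)
  thus ?thesis by (auto simp: adj_def intro!: sum_nonneg)
qed

lemma quad_form_mono_abs:
  assumes "\<And>i j. a i j \<ge> 0"
  shows "quad_form V a x \<le> quad_form V a (\<lambda>i. \<bar>x i\<bar>)"
  unfolding quad_form_def
proof (intro sum_mono)
  fix i j
  have "a i j * (x i * x j) \<le> a i j * (\<bar>x i\<bar> * \<bar>x j\<bar>)"
    using assms by (intro mult_left_mono) (auto simp flip: abs_mult)
  thus "a i j * x i * x j \<le> a i j * \<bar>x i\<bar> * \<bar>x j\<bar>" by (simp add: mult_ac)
qed

text \<open>The maximum \<open>l\<close> of the form on the unit sphere is itself an eigenvalue. It
  dominates every other one: for a complex eigenvector \<open>z\<close>, the triangle inequality and
  nonnegative entries bound \<open>cmod \<mu>\<close> times the squared norm of \<open>z\<close> by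
  the form at the entrywise moduli of \<open>z\<close>.\<close>

lemma spectral_radius_rayleigh:
  fixes V :: "'a set"
  assumes hg: "hypergraph V E"
  obtains x where "\<And>i. x i \<ge> 0" "(\<Sum>i\<in>V. (x i)\<^sup>2) = 1"
    "quad_form V (adj E) x = spectral_radius V E"
    "\<And>y. quad_form V (adj E) y \<le> spectral_radius V E * (\<Sum>i\<in>V. (y i)\<^sup>2)"
proof -
  have fin: "finite V" and ne: "V \<noteq> {}" using hg by (auto simp: hypergraph_def)
  note nn = adj_nonneg[OF hg]
  obtain x0 where x0: "(\<Sum>i\<in>V. (x0 i)\<^sup>2) = 1"
    "\<And>y. quad_form V (adj E) y \<le> quad_form V (adj E) x0 * (\<Sum>i\<in>V. (y i)\<^sup>2)"
    using quad_form_attains_max[OF fin ne] by blast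
  \<comment> \<open>Entrywise moduli keep the norm and, the entries being nonnegative, do not lower
    the form, so a maximiser may be taken nonnegative.\<close>
  define x where "x = (\<lambda>i. \<bar>x0 i\<bar>)"
  define l where "l = quad_form V (adj E) x0"
  have x1: "(\<Sum>i\<in>V. (x i)\<^sup>2) = 1" using x0(1) by (simp add: x_def)
  have bound: "quad_form V (adj E) y \<le> l * (\<Sum>i\<in>V. (y i)\<^sup>2)" for y
    using x0(2) by (simp add: l_def)
  have ql: "quad_form V (adj E) x = l"
    using quad_form_mono_abs[where a = "adj E", OF nn, of V x0] bound[of x] x1 by (simp add: l_def x_def)
  have l0: "l \<ge> 0"
    unfolding ql[symmetric] quad_form_def x_def
    by (intro sum_nonneg mult_nonneg_nonneg nn) auto
  have eig: "(\<Sum>j\<in>V. adj E i j * x j) = l * x i" if "i \<in> V" for i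
    using quad_form_max_eigenvector[OF fin adj_commute bound, of x] ql x1 that by simp
  have "is_eigenvalue V E (complex_of_real l)"
    unfolding is_eigenvalue_def
  proof (intro exI[of _ "\<lambda>i. complex_of_real (x i)"] conjI ballI)
    show "\<exists>v\<in>V. complex_of_real (x v) \<noteq> 0"
    proof (rule ccontr)
      assume "\<not> ?thesis"
      hence "(\<Sum>i\<in>V. (x i)\<^sup>2) = 0" by simp
      thus False using x1 by simp
    qed
    fix i assume "i \<in> V"
    from eig[OF this]
    show "(\<Sum>j\<in>V. complex_of_real (adj E i j) * complex_of_real (x j)) = complex_of_real l * complex_of_real (x i)"
      by (metis (no_types, lifting) of_real_mult of_real_sum sum.cong)
  qed
  moreover have "cmod \<mu> \<le> l" if "is_eigenvalue V E \<mu>" for \<mu>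
  proof -
    from that obtain z :: "'a \<Rightarrow> complex" and v where v: "v \<in> V" "z v \<noteq> 0"
      and z: "\<And>i. i \<in> V \<Longrightarrow> (\<Sum>j\<in>V. complex_of_real (adj E i j) * z j) = \<mu> * z i"
      unfolding is_eigenvalue_def by blast
    define N where "N = (\<Sum>i\<in>V. (cmod (z i))\<^sup>2)"
    have "(cmod (z v))\<^sup>2 \<le> N" unfolding N_def using fin v by (intro member_le_sum) auto
    moreover have "(cmod (z v))\<^sup>2 > 0" using v by simp
    ultimately have "N > 0" by linarith
    have "cmod \<mu> * N = (\<Sum>i\<in>V. cmod (z i) * cmod (\<mu> * z i))"
      unfolding N_def sum_distrib_left
      by (intro sum.cong refl) (simp add: norm_mult power2_eq_square mult_ac)
    also have "\<dots> \<le> (\<Sum>i\<in>V. cmod (z i) * (\<Sum>j\<in>V. adj E i j * cmod (z j)))"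
    proof (intro sum_mono mult_left_mono)
      fix i assume "i \<in> V"
      have "cmod (\<mu> * z i) = cmod (\<Sum>j\<in>V. complex_of_real (adj E i j) * z j)"
        using z[OF \<open>i \<in> V\<close>] by simp
      also have "\<dots> \<le> (\<Sum>j\<in>V. cmod (complex_of_real (adj E i j) * z j))" by (rule norm_sum)
      also have "\<dots> = (\<Sum>j\<in>V. adj E i j * cmod (z j))"
        using nn by (simp add: norm_mult)
      finally show "cmod (\<mu> * z i) \<le> (\<Sum>j\<in>V. adj E i j * cmod (z j))" .
    qed auto
    also have "\<dots> = quad_form V (adj E) (\<lambda>i. cmod (z i))"
      by (simp add: quad_form_altdef)
    also have "\<dots> \<le> l * N" using bound[of "\<lambda>i. cmod (z i)"] by (simp add: N_def)
    finally show ?thesis using \<open>N > 0\<close> by simp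
  qed
  ultimately have "spectral_radius V E = l"
    unfolding spectral_radius_def using finite_eigenvalues[OF fin] l0
    by (intro Max_eqI) (auto intro!: image_eqI[of _ _ "complex_of_real l"])
  thus thesis using that[of x] x1 ql bound by (auto simp: x_def)
qed

text \<open>Zeros spread: where \<open>x\<close> vanishes, the eigenvalue equation is a vanishing
  sum of nonnegative terms, so \<open>x\<close> vanishes on all adjacent vertices, and by
  connectivity on all of \<open>V\<close>.\<close>

lemma eigenvector_connected_pos:
  assumes hg: "hypergraph V E" and finE: "finite E" and con: "hg_connected V E"
    and nn: "\<And>i. x i \<ge> 0" and nz: "\<exists>i\<in>V. x i \<noteq> 0"
    and eig: "\<And>i. i \<in> V \<Longrightarrow> (\<Sum>j\<in>V. adj E i j * x j) = l * x i"
    and i: "i \<in> V"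
  shows "x i > (0::real)"
proof (rule ccontr)
  assume "\<not> x i > 0"
  with nn[of i] have xi: "x i = 0" by simp
  have fin: "finite V" using hg by (auto simp: hypergraph_def)
  have step: "x w = 0" if "w \<in> e" "v \<in> e" "e \<in> E" "x v = 0" for v w e
  proof (cases "v = w")
    case False
    have ev: "v \<in> V" "w \<in> V" using hg that by (auto simp: hypergraph_def)
    have "(\<Sum>j\<in>V. adj E v j * x j) = 0" using eig[OF ev(1)] that by simp
    hence "adj E v w * x w = 0"
      using ev fin adj_nonneg[OF hg] nn by (subst (asm) sum_nonneg_eq_0_iff) auto
    moreover have "adj E v w > 0"
    proof -
      have "1 / (real (card e) - 1) > 0"
        using hg that by (auto simp: hypergraph_def)
      also have "1 / (real (card e) - 1) \<le> (\<Sum>e\<in>{e \<in> E. v \<in> e \<and> w \<in> e}. 1 / (real (card e) - 1))"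
        using hg that finE by (intro member_le_sum) (auto simp: hypergraph_def)
      finally show ?thesis using False by (simp add: adj_def)
    qed
    ultimately show ?thesis by simp
  qed (use that in simp)
  have "x w = 0" if "w \<in> V" for w
  proof -
    have "(i, w) \<in> {(u, v). \<exists>e\<in>E. u \<in> e \<and> v \<in> e}\<^sup>*"
      using con i that by (auto simp: hg_connected_def)
    thus ?thesis by (induction rule: rtrancl_induct) (use xi step in auto)
  qed
  thus False using nz by auto
qed

text \<open>Eigenvectors are transported along the bijection in both directions, so the spectra
  coincide. Edges inside \<open>V\<close> ensure that taking images is injective on edges and
  preserves incidence and size.\<close>

lemma hg_iso_spectral_radius:
  assumes E: "\<And>e. e \<in> E \<Longrightarrow> e \<subseteq> V" and iso: "hg_iso V E V' E'"
  shows "spectral_radius V E = spectral_radius V' E'"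
proof -
  obtain f where f: "bij_betw f V V'" and E': "E' = (\<lambda>e. f ` e) ` E"
    using iso unfolding hg_iso_def by auto
  have inj: "inj_on f V" using f by (simp add: bij_betw_def)
  have injE: "inj_on (\<lambda>e. f ` e) E"
    using inj E by (intro inj_onI) (metis inj_on_image_eq_iff)
  have adj: "adj E' (f i) (f j) = adj E i j" if "i \<in> V" "j \<in> V" for i j
  proof -
    have mem: "f v \<in> f ` e \<longleftrightarrow> v \<in> e" if "v \<in> V" "e \<in> E" for v e
      using inj E that by (meson inj_on_image_mem_iff)
    have "{e \<in> E'. f i \<in> e \<and> f j \<in> e} = (\<lambda>e. f ` e) ` {e \<in> E. i \<in> e \<and> j \<in> e}"
      using mem that by (auto simp: E')
    moreover have "inj_on (\<lambda>e. f ` e) {e \<in> E. i \<in> e \<and> j \<in> e}"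
      using injE by (rule inj_on_subset) auto
    moreover have "card (f ` e) = card e" if "e \<in> E" for e
      using inj E that by (meson card_image inj_on_subset)
    moreover have "f i = f j \<longleftrightarrow> i = j" using inj that by (auto dest: inj_onD)
    ultimately show ?thesis by (simp add: adj_def sum.reindex)
  qed
  have "is_eigenvalue V E \<mu> \<longleftrightarrow> is_eigenvalue V' E' \<mu>" for \<mu>
  proof
    assume "is_eigenvalue V E \<mu>"
    then obtain x :: "'a \<Rightarrow> complex" and v where v: "v \<in> V" "x v \<noteq> 0"
      and x: "\<And>i. i \<in> V \<Longrightarrow> (\<Sum>j\<in>V. complex_of_real (adj E i j) * x j) = \<mu> * x i"
      unfolding is_eigenvalue_def by blast
    define y where "y = x \<circ> inv_into V f"
    have y: "y (f i) = x i" if "i \<in> V" for i using inj that by (simp add: y_def)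
    have "(\<Sum>j\<in>V'. complex_of_real (adj E' (f i) j) * y j) = \<mu> * y (f i)" if "i \<in> V" for i
      unfolding x[OF that, symmetric] y[OF that]
      by (subst sum.reindex_bij_betw[OF f, symmetric]) (simp add: that y adj)
    moreover have "y (f v) \<noteq> 0" "f v \<in> V'" using v y f by (auto simp: bij_betw_def)
    ultimately show "is_eigenvalue V' E' \<mu>"
      unfolding is_eigenvalue_def using f by (intro exI[of _ y]) (auto simp: bij_betw_def)
  next
    assume "is_eigenvalue V' E' \<mu>"
    then obtain y :: "'b \<Rightarrow> complex" and v where v: "v \<in> V'" "y v \<noteq> 0"
      and y: "\<And>i. i \<in> V' \<Longrightarrow> (\<Sum>j\<in>V'. complex_of_real (adj E' i j) * y j) = \<mu> * y i"
      unfolding is_eigenvalue_def by blast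
    have "(\<Sum>j\<in>V. complex_of_real (adj E i j) * y (f j)) = \<mu> * y (f i)" if "i \<in> V" for i
    proof -
      have "f i \<in> V'" using f that by (auto simp: bij_betw_def)
      show ?thesis unfolding y[OF \<open>f i \<in> V'\<close>, symmetric]
        by (subst sum.reindex_bij_betw[OF f, symmetric]) (simp add: that adj)
    qed
    moreover have "\<exists>w\<in>V. y (f w) \<noteq> 0" using v f by (auto simp: bij_betw_def)
    ultimately show "is_eigenvalue V E \<mu>"
      unfolding is_eigenvalue_def by (intro exI[of _ "\<lambda>i. y (f i)"]) auto
  qed
  thus ?thesis by (simp add: spectral_radius_def)
qed

section \<open>Rooting a supertree\<close>

text \<open>Lists are used as in \<open>has_berge_cycle\<close>, with one more vertex than edges.
  \<open>W\<close> and \<open>F\<close> bound the vertices and edges used, so that a vertex or edge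
  outside them can be appended without losing distinctness.\<close>

definition berge_path :: "'a set \<Rightarrow> 'a set set \<Rightarrow> 'a \<Rightarrow> 'a \<Rightarrow> bool" where
  "berge_path W F a b \<longleftrightarrow> (\<exists>vs es. length vs = Suc (length es) \<and> distinct vs \<and> distinct es \<and>
     set vs \<subseteq> W \<and> set es \<subseteq> F \<and> vs ! 0 = a \<and> vs ! length es = b \<and>
     (\<forall>i<length es. vs ! i \<in> es ! i \<and> vs ! Suc i \<in> es ! i))"

lemma berge_path_refl: "a \<in> W \<Longrightarrow> berge_path W F a a"
  unfolding berge_path_def by (intro exI[of _ "[a]"] exI[of _ "[]"]) auto

lemma berge_path_edge:
  assumes "a \<noteq> b" "a \<in> e" "b \<in> e" "e \<in> F" "e \<subseteq> W"
  shows "berge_path W F a b"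
  unfolding berge_path_def using assms by (intro exI[of _ "[a, b]"] exI[of _ "[e]"]) auto

lemma berge_path_mono: "berge_path W F a b \<Longrightarrow> W \<subseteq> W' \<Longrightarrow> F \<subseteq> F' \<Longrightarrow> berge_path W' F' a b"
  unfolding berge_path_def by (elim exE, intro exI) auto

lemma berge_path_sym:
  assumes "berge_path W F a b"
  shows "berge_path W F b a"
proof -
  obtain vs es where *: "length vs = Suc (length es)" "distinct vs" "distinct es"
     "set vs \<subseteq> W" "set es \<subseteq> F" "vs ! 0 = a" "vs ! length es = b"
     "\<And>i. i < length es \<Longrightarrow> vs ! i \<in> es ! i \<and> vs ! Suc i \<in> es ! i"
    using assms unfolding berge_path_def by blast
  have "rev vs ! i \<in> rev es ! i \<and> rev vs ! Suc i \<in> rev es ! i" if "i < length es" for i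
  proof -
    have "Suc (length es - Suc i) = length es - i" using that by simp
    thus ?thesis using *(8)[of "length es - Suc i"] that *(1) by (simp add: rev_nth)
  qed
  thus ?thesis unfolding berge_path_def
    using * by (intro exI[of _ "rev vs"] exI[of _ "rev es"]) (auto simp: rev_nth)
qed

lemma berge_path_Cons:
  assumes "berge_path W F b c" "a \<notin> W" "e \<notin> F" "a \<in> e" "b \<in> e"
  shows "berge_path (insert a W) (insert e F) a c"
proof -
  obtain vs es where *: "length vs = Suc (length es)" "distinct vs" "distinct es"
     "set vs \<subseteq> W" "set es \<subseteq> F" "vs ! 0 = b" "vs ! length es = c"
     "\<And>i. i < length es \<Longrightarrow> vs ! i \<in> es ! i \<and> vs ! Suc i \<in> es ! i"
    using assms unfolding berge_path_def by blast
  show ?thesis unfolding berge_path_def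
    using * assms by (intro exI[of _ "a # vs"] exI[of _ "e # es"]) (auto simp: nth_Cons split: nat.splits)
qed

lemma berge_path_close:
  assumes "berge_path W F a b" "e \<notin> F" "F \<subseteq> E" "e \<in> E" "a \<in> e" "b \<in> e" "a \<noteq> b"
  shows "has_berge_cycle E"
proof -
  obtain vs es where *: "length vs = Suc (length es)" "distinct vs" "distinct es"
     "set vs \<subseteq> W" "set es \<subseteq> F" "vs ! 0 = a" "vs ! length es = b"
     "\<And>i. i < length es \<Longrightarrow> vs ! i \<in> es ! i \<and> vs ! Suc i \<in> es ! i"
    using assms unfolding berge_path_def by blast
  \<comment> \<open>Distinct endpoints force at least one edge, hence the two vertices that a cycle
    requires.\<close>
  have "es \<noteq> []" using * assms(7) by auto
  hence "2 \<le> length vs" using *(1) by (cases es) auto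
  \<comment> \<open>The index wraps around only at the end, where \<open>e\<close> joins
    \<open>b\<close> back to \<open>a\<close>.\<close>
  moreover have "vs ! i \<in> (es @ [e]) ! i \<and> vs ! ((i + 1) mod length vs) \<in> (es @ [e]) ! i"
    if "i < length vs" for i
  proof (cases "i < length es")
    case True
    hence "(i + 1) mod length vs = Suc i" using *(1) by simp
    thus ?thesis using *(8)[OF True] True by (simp add: nth_append)
  next
    case False
    hence "i = length es" using that *(1) by simp
    thus ?thesis using * assms by simp
  qed
  ultimately show ?thesis unfolding has_berge_cycle_def
    using * assms by (intro exI[of _ vs] exI[of _ "es @ [e]"]) auto
qed

text \<open>Otherwise \<open>W\<close> would be closed under adjacency, and everything reachable
  from \<open>u\<close> would stay inside it.\<close>

lemma hg_connected_crossing: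
  assumes "hg_connected V E" "u \<in> W" "u \<in> V" "y \<in> V" "y \<notin> W"
  obtains e where "e \<in> E" "e \<inter> W \<noteq> {}" "\<not> e \<subseteq> W"
proof (rule ccontr)
  assume "\<not> thesis"
  hence *: "\<And>e. e \<in> E \<Longrightarrow> e \<inter> W \<noteq> {} \<Longrightarrow> e \<subseteq> W" using that by blast
  have "(u, y) \<in> {(u, v). \<exists>e\<in>E. u \<in> e \<and> v \<in> e}\<^sup>*"
    using assms by (auto simp: hg_connected_def)
  hence "y \<in> W" by (induction rule: rtrancl_induct) (use assms * in blast)+
  thus False using assms by simp
qed

text \<open>Here \<open>p e\<close> is the vertex of \<open>e\<close> closest to the root \<open>u\<close>. Each edge is added to the part
  \<open>W\<close> already reached, and acyclicity forces it to meet \<open>W\<close> in the single vertex \<open>p e\<close>. The last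
  alternative records the first edge added away from the root.\<close>

definition rooted_at :: "'a \<Rightarrow> 'a set \<Rightarrow> 'a set set \<Rightarrow> ('a set \<Rightarrow> 'a) \<Rightarrow> bool" where
  "rooted_at u W F p \<longleftrightarrow> u \<in> W \<and> (\<forall>e\<in>F. p e \<in> e) \<and>
     (\<forall>e\<in>F. \<forall>e'\<in>F. e \<noteq> e' \<longrightarrow> (e - {p e}) \<inter> (e' - {p e'}) = {}) \<and>
     W - {u} = (\<Union>e\<in>F. e - {p e}) \<and>
     ((\<forall>e\<in>F. p e = u) \<or> (\<exists>e\<in>F. \<exists>f\<in>F. p e \<noteq> u \<and> p f = u \<and> p e \<in> f))"

text \<open>The children of the new edge are exactly its vertices outside \<open>W\<close>, so they
  are disjoint from all earlier child sets, and \<open>q\<close> becomes its parent.\<close>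

lemma rooted_at_extend:
  assumes r: "rooted_at u W F p" and W: "\<And>f. f \<in> F \<Longrightarrow> f \<subseteq> W"
    and e: "e \<notin> F" "e \<inter> W = {q}"
  shows "rooted_at u (W \<union> e) (insert e F) (p(e := q))"
proof -
  define p' where "p' = p(e := q)"
  have p': "p' e = q" "\<And>f. f \<in> F \<Longrightarrow> p' f = p f" using e by (auto simp: p'_def)
  have q: "q \<in> e" "q \<in> W" using e by auto
  have u: "u \<in> W" using r by (simp add: rooted_at_def)
  have disj: "(e - {q}) \<inter> W = {}" using e by auto
  have part: "W - {u} = (\<Union>f\<in>F. f - {p f})" using r by (simp add: rooted_at_def)
  have "\<forall>f\<in>insert e F. p' f \<in> f" using r p' q by (auto simp: rooted_at_def)
  moreover have "\<forall>f\<in>insert e F. \<forall>f'\<in>insert e F. f \<noteq> f' \<longrightarrow> (f - {p' f}) \<inter> (f' - {p' f'}) = {}"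
  proof (intro ballI impI)
    fix f f' assume f: "f \<in> insert e F" "f' \<in> insert e F" "f \<noteq> f'"
    have "(f - {p f}) \<inter> (f' - {p f'}) = {}" if "f \<in> F" "f' \<in> F"
      using r f(3) that by (simp add: rooted_at_def)
    moreover have "(e - {q}) \<inter> (g - {p g}) = {}" if "g \<in> F" for g
      using disj W[OF that] by auto
    ultimately show "(f - {p' f}) \<inter> (f' - {p' f'}) = {}"
      using f p' by (metis inf_commute insert_iff)
  qed
  moreover have "(W \<union> e) - {u} = (\<Union>f\<in>insert e F. f - {p' f})"
  proof -
    have "(W \<union> e) - {u} = (W - {u}) \<union> (e - {q})" using disj u q by auto
    also have "\<dots> = (\<Union>f\<in>insert e F. f - {p' f})" using part p' by auto
    finally show ?thesis .
  qed
  moreover have "(\<forall>f\<in>insert e F. p' f = u) \<or> (\<exists>g\<in>insert e F. \<exists>f\<in>insert e F. p' g \<noteq> u \<and> p' f = u \<and> p' g \<in> f)"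
  proof (cases "\<forall>f\<in>F. p f = u")
    case True
    show ?thesis
    proof (cases "q = u")
      case True
      thus ?thesis using \<open>\<forall>f\<in>F. p f = u\<close> p' by auto
    next
      case False
      \<comment> \<open>So far all parents are \<open>u\<close>, so the edge having \<open>q\<close>
        as a child is attached at \<open>u\<close>: the required witness for the last
        alternative.\<close>
      then obtain f where "f \<in> F" "q \<in> f" using part q(2) by blast
      thus ?thesis using True False p' by (intro disjI2 bexI[of _ e] bexI[of _ f]) auto
    qed
  next
    case False
    then obtain g f where "g \<in> F" "f \<in> F" "p g \<noteq> u" "p f = u" "p g \<in> f"
      using r unfolding rooted_at_def by blast
    thus ?thesis using p' by (intro disjI2 bexI[of _ g] bexI[of _ f]) auto
  qed
  ultimately show ?thesis using u unfolding rooted_at_def p'_def by blast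
qed

text \<open>Edges are added one at a time. The invariant that any two reached vertices are joined by
  a Berge path within the reached part is what lets acyclicity act: a new edge meeting
  \<open>W\<close> twice would close a cycle.\<close>

lemma supertree_rooted:
  assumes st: "supertree V E" and u: "u \<in> V"
  obtains p where "rooted_at u V E p"
proof -
  have hg: "hypergraph V E" and con: "hg_connected V E" and acyc: "\<not> has_berge_cycle E"
    using st by (auto simp: supertree_def)
  have EV: "\<And>e. e \<in> E \<Longrightarrow> e \<subseteq> V" and c2: "\<And>e. e \<in> E \<Longrightarrow> 2 \<le> card e" and finV: "finite V"
    using hg by (auto simp: hypergraph_def)
  have finE: "finite E" using EV finV by (meson Pow_iff finite_Pow_iff finite_subset subsetI)
  have "\<exists>W F p. F \<subseteq> E \<and> card F = m \<and> W \<subseteq> V \<and> (\<forall>f\<in>F. f \<subseteq> W) \<and>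
      (\<forall>a\<in>W. \<forall>b\<in>W. berge_path W F a b) \<and> rooted_at u W F p" if "m \<le> card E" for m
    using that
  proof (induction m)
    case 0
    show ?case
      by (rule exI[of _ "{u}"], rule exI[of _ "{}"], rule exI[of _ "\<lambda>_. u"])
         (use u in \<open>auto simp: rooted_at_def berge_path_refl\<close>)
  next
    case (Suc m)
    then obtain W F p where IH: "F \<subseteq> E" "card F = m" "W \<subseteq> V" "\<And>f. f \<in> F \<Longrightarrow> f \<subseteq> W"
      "\<And>a b. a \<in> W \<Longrightarrow> b \<in> W \<Longrightarrow> berge_path W F a b" "rooted_at u W F p" by auto
    have finF: "finite F" using IH(1) finE finite_subset by blast
    have uW: "u \<in> W" using IH(6) by (simp add: rooted_at_def)
    \<comment> \<open>If every vertex is reached, any remaining edge meets \<open>W\<close>;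
      otherwise connectivity supplies an edge leaving \<open>W\<close>, which cannot lie in
      \<open>F\<close>.\<close>
    have "\<exists>e. e \<in> E \<and> e \<notin> F \<and> e \<inter> W \<noteq> {}"
    proof (cases "W = V")
      case True
      have "F \<noteq> E" using IH(2) Suc.prems by auto
      then obtain e where "e \<in> E" "e \<notin> F" using IH(1) by blast
      moreover have "e \<inter> W \<noteq> {}" using c2[OF \<open>e \<in> E\<close>] EV[OF \<open>e \<in> E\<close>] True by (cases "e = {}") auto
      ultimately show ?thesis by blast
    next
      case False
      then obtain y where "y \<in> V" "y \<notin> W" using IH(3) by blast
      from hg_connected_crossing[OF con uW u this] obtain e where "e \<in> E" "e \<inter> W \<noteq> {}" "\<not> e \<subseteq> W" .
      thus ?thesis using IH(4) by blast
    qed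
    then obtain e q where e: "e \<in> E" "e \<notin> F" and q: "q \<in> e" "q \<in> W" by blast
    have uniq: "w = q" if "w \<in> e" "w \<in> W" for w
    proof (rule ccontr)
      assume "w \<noteq> q"
      with berge_path_close[OF IH(5)[OF that(2) q(2)] e(2) IH(1) e(1) that(1) q(1)]
      have "has_berge_cycle E" .
      thus False using acyc by contradiction
    qed
    hence eW: "e \<inter> W = {q}" using q by blast
    have new: "berge_path (W \<union> e) (insert e F) a b" if "a \<in> e" "a \<notin> W" "b \<in> W" for a b
      using berge_path_Cons[OF IH(5)[OF q(2) that(3)] that(2) e(2) that(1) q(1)]
      by (rule berge_path_mono) (use that in auto)
    have paths: "berge_path (W \<union> e) (insert e F) a b" if "a \<in> W \<union> e" "b \<in> W \<union> e" for a b
    proof -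
      consider "a \<in> W" "b \<in> W" | "a \<notin> W" "b \<in> W" | "a \<in> W" "b \<notin> W" | "a \<notin> W" "b \<notin> W" by blast
      thus ?thesis
      proof cases
        case 1
        from IH(5)[OF this] show ?thesis by (rule berge_path_mono) auto
      next
        case 2 thus ?thesis using new that by auto
      next
        case 3 thus ?thesis using new[of b a] that by (auto intro: berge_path_sym)
      next
        case 4 thus ?thesis using that
          by (cases "a = b") (auto intro: berge_path_refl berge_path_edge)
      qed
    qed
    obtain p' where "rooted_at u (W \<union> e) (insert e F) p'"
      using rooted_at_extend[OF IH(6) IH(4) e(2) eW] by blast
    thus ?case
      by (intro exI[of _ "W \<union> e"] exI[of _ "insert e F"] exI[of _ p'])
         (use IH(1-4) e EV[OF e(1)] finF paths in auto)
  qed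
  from this[OF order_refl] obtain W F p where *: "F \<subseteq> E" "card F = card E" "W \<subseteq> V"
     "\<forall>f\<in>F. f \<subseteq> W" "rooted_at u W F p"
    by (elim exE conjE) (rule that)
  have FE: "F = E" using *(1,2) finE by (simp add: card_subset_eq)
  have "W = V"
  proof (rule ccontr)
    assume "W \<noteq> V"
    then obtain y where y: "y \<in> V" "y \<notin> W" using * by blast
    have "u \<in> W" using * by (simp add: rooted_at_def)
    from hg_connected_crossing[OF con this u y] obtain e where "e \<in> E" "\<not> e \<subseteq> W" .
    thus False using *(4) FE by blast
  qed
  thus thesis using that *(5) FE by simp
qed

section \<open>Recognising superstars and double hyperstars\<close>

lemma UN_consecutive_intervals:
  assumes "(d::nat) > 0"
  shows "(\<Union>i<m. {1 + i * d..<1 + (i + 1) * d}) = {1..<1 + m * d}"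
proof (induction m)
  case (Suc m)
  have "(\<Union>i<Suc m. {1 + i * d..<1 + (i + 1) * d}) = {1..<1 + m * d} \<union> {1 + m * d..<1 + (m + 1) * d}"
    unfolding lessThan_Suc UN_insert Suc.IH by blast
  also have "\<dots> = {1..<1 + Suc m * d}" by (auto simp: ivl_disj_un)
  finally show ?case .
qed simp

text \<open>Each block goes onto the interval of its index and \<open>u\<close> to 0. The
  normalisation \<open>f v = 1\<close> matches the second centre of \<open>dstar_E\<close>.
  Injectivity comes from counting: the map is onto a set of the same size.\<close>

lemma block_bijection:
  fixes C :: "nat \<Rightarrow> 'a set"
  assumes d: "d > 0" and m: "m > 0"
    and card: "\<And>i. i < m \<Longrightarrow> card (C i) = d"
    and disj: "\<And>i j. i < m \<Longrightarrow> j < m \<Longrightarrow> i \<noteq> j \<Longrightarrow> C i \<inter> C j = {}"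
    and u: "\<And>i. i < m \<Longrightarrow> u \<notin> C i" and v: "v \<in> C 0"
    and V: "V = insert u (\<Union>i<m. C i)"
  obtains f where "bij_betw f V {..<1 + m * d}" "f u = 0" "f v = 1"
    "\<And>i. i < m \<Longrightarrow> f ` C i = {1 + i * d..<1 + (i + 1) * d}"
proof -
  let ?I = "\<lambda>i. {1 + i * d..<1 + (i + 1) * d}"
  have fin: "finite (C i)" if "i < m" for i using card[OF that] d by (simp add: card_ge_0_finite)
  have "\<exists>h. h ` C i = ?I i \<and> (i = 0 \<longrightarrow> h v = 1)" if i: "i < m" for i
  proof (cases "i = 0")
    case True
    have "card (C 0 - {v}) = card (?I 0 - {1})"
      using card[OF m] v fin[OF m] d by (simp add: card_Diff_singleton)
    then obtain h where h: "bij_betw h (C 0 - {v}) (?I 0 - {1})"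
      using fin[OF m] by (metis finite_Diff finite_atLeastLessThan finite_same_card_bij)
    have "(h(v := 1)) ` C 0 = insert 1 (h ` (C 0 - {v}))"
      using v by (auto simp: image_def)
    also have "\<dots> = ?I 0" using h d by (auto simp: bij_betw_def)
    finally show ?thesis using True by (intro exI[of _ "h(v := 1)"]) auto
  next
    case False
    have "card (C i) = card (?I i)" using card[OF i] by simp
    then obtain h where "bij_betw h (C i) (?I i)"
      using fin[OF i] by (metis finite_atLeastLessThan finite_same_card_bij)
    thus ?thesis using False by (auto simp: bij_betw_def)
  qed
  then obtain h where h: "\<And>i. i < m \<Longrightarrow> h i ` C i = ?I i" "h 0 v = 1"
    using m by metis
  \<comment> \<open>The blocks are disjoint, so the description picks the only block containing
    \<open>w\<close>.\<close>
  define f where "f = (\<lambda>w. if w = u then 0 else h (THE i. i < m \<and> w \<in> C i) w)"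
  have f: "f w = h i w" if "i < m" "w \<in> C i" for i w
  proof -
    have "(THE i. i < m \<and> w \<in> C i) = i"
      using that disj by (intro the_equality) blast+
    thus ?thesis using that u by (auto simp: f_def)
  qed
  have img: "f ` C i = ?I i" if "i < m" for i
    using h(1)[OF that] f[OF that] by (metis (no_types, lifting) image_cong)
  have fu: "f u = 0" by (simp add: f_def)
  have "f ` V = insert 0 (\<Union>i<m. ?I i)"
    unfolding V image_insert image_UN fu using img by auto
  also have "\<dots> = {..<1 + m * d}"
    unfolding UN_consecutive_intervals[OF d] by auto
  finally have fV: "f ` V = {..<1 + m * d}" .
  have "card (\<Union>i<m. C i) = (\<Sum>i<m. card (C i))"
    using fin disj by (intro card_UN_disjoint) auto
  hence "card V = 1 + m * d"
    unfolding V using u fin card by (subst card_insert_disjoint) auto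
  moreover have "finite V" unfolding V using fin by auto
  ultimately have "inj_on f V" using fV by (intro eq_card_imp_inj_on) auto
  thus thesis
    using that[of f] fV fu f[OF m v] h(2) img by (auto simp: bij_betw_def)
qed

lemma superstar_iso:
  fixes C :: "nat \<Rightarrow> 'a set"
  assumes "k \<ge> 2" "m > 0"
    and "\<And>i. i < m \<Longrightarrow> card (C i) = k - 1"
    and "\<And>i j. i < m \<Longrightarrow> j < m \<Longrightarrow> i \<noteq> j \<Longrightarrow> C i \<inter> C j = {}"
    and "\<And>i. i < m \<Longrightarrow> u \<notin> C i"
    and "V = insert u (\<Union>i<m. C i)"
  shows "hg_iso V ((\<lambda>i. insert u (C i)) ` {..<m}) (superstar_V (1 + m * (k - 1))) (superstar_E (1 + m * (k - 1)) k)"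
proof -
  obtain v where v: "v \<in> C 0" using assms(1) assms(3)[OF \<open>m > 0\<close>] by fastforce
  obtain f where f: "bij_betw f V {..<1 + m * (k - 1)}" "f u = 0" "f v = 1"
    "\<And>i. i < m \<Longrightarrow> f ` C i = {1 + i * (k - 1)..<1 + (i + 1) * (k - 1)}"
    using block_bijection[OF _ assms(2-5) v assms(6)] assms(1) by auto
  have "(1 + m * (k - 1) - 1) div (k - 1) = m" using assms(1) by simp
  hence "(\<lambda>e. f ` e) ` (\<lambda>i. insert u (C i)) ` {..<m} = superstar_E (1 + m * (k - 1)) k"
    unfolding superstar_E_def image_image image_insert f(2) by (intro image_cong) (simp_all only: f(4) lessThan_iff)
  thus ?thesis unfolding hg_iso_def superstar_V_def using f(1) by blast
qed

text \<open>Block 0 contains \<open>v\<close>, so together with \<open>u\<close> it is the central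
  edge; blocks 1 to \<open>l\<close> give the pendant edges at \<open>u\<close>, and the last block,
  of index \<open>l + 1\<close>, the one at \<open>v\<close>.\<close>

lemma dstar_iso:
  fixes C :: "nat \<Rightarrow> 'a set"
  assumes "k \<ge> 2" and m: "m = l + 2"
    and "\<And>i. i < m \<Longrightarrow> card (C i) = k - 1"
    and "\<And>i j. i < m \<Longrightarrow> j < m \<Longrightarrow> i \<noteq> j \<Longrightarrow> C i \<inter> C j = {}"
    and "\<And>i. i < m \<Longrightarrow> u \<notin> C i" and v: "v \<in> C 0"
    and "V = insert u (\<Union>i<m. C i)"
  shows "hg_iso V ((\<lambda>i. insert (if i = l + 1 then v else u) (C i)) ` {..<m}) (dstar_V k l 1) (dstar_E k l 1)"
proof -
  let ?I = "\<lambda>i. {1 + i * (k - 1)..<1 + (i + 1) * (k - 1)}"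
  have m0: "m > 0" using m by simp
  obtain f where f: "bij_betw f V {..<1 + m * (k - 1)}" "f u = 0" "f v = 1"
    "\<And>i. i < m \<Longrightarrow> f ` C i = ?I i"
    using block_bijection[OF _ m0 assms(3-7)] assms(1) by auto
  have "{..<m} = insert 0 (Suc ` {..<l} \<union> {Suc l})"
    using lessThan_Suc_eq_insert_0[of "Suc l"] by (simp add: m lessThan_Suc insert_commute)
  hence "(\<lambda>i. insert (if i = l + 1 then 1 else 0) (?I i)) ` {..<m}
      = insert (insert 0 (?I 0)) ((\<lambda>i. insert 0 (?I (Suc i))) ` {..<l} \<union> {insert 1 (?I (Suc l))})"
    by (simp add: image_Un image_image)
  moreover have "insert 0 (?I 0) = {..<k}" using assms(1) by auto
  \<comment> \<open>Indices shift by one because \<open>dstar_E\<close> numbers pendant edges after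
    the central edge, which occupies block 0.\<close>
  moreover have "?I (Suc i) = {k + i * (k - 1)..<k + (i + 1) * (k - 1)}" for i
    using assms(1) by (cases k) auto
  ultimately have "(\<lambda>i. insert (if i = l + 1 then 1 else 0) (?I i)) ` {..<m} = dstar_E k l 1"
    unfolding dstar_E_def by simp
  moreover have "(\<lambda>e. f ` e) ` (\<lambda>i. insert (if i = l + 1 then v else u) (C i)) ` {..<m}
     = (\<lambda>i. insert (if i = l + 1 then 1 else 0) (?I i)) ` {..<m}"
    unfolding image_image image_insert by (intro image_cong refl) (use f in auto)
  moreover have "1 + m * (k - 1) = k + (l + 1) * (k - 1)" using assms(1) m by (cases k) auto
  ultimately show ?thesis unfolding hg_iso_def dstar_V_def using f(1) by metis
qed

section \<open>Regrafting edges\<close>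

text \<open>Neighbours are grouped by the edges through \<open>i\<close>; uniformity gives all edges
  the same weight.\<close>

lemma adj_row_uniform:
  assumes fin: "finite V" "finite E" and E: "\<And>e. e \<in> E \<Longrightarrow> e \<subseteq> V \<and> card e = k"
  shows "(\<Sum>j\<in>V. adj E i j * x j) = (\<Sum>e\<in>{e \<in> E. i \<in> e}. sum x e - x i) / (real k - 1)"
proof -
  have "adj E i j * x j = (\<Sum>e\<in>{e \<in> E. i \<in> e}. if j \<in> e - {i} then x j / (real k - 1) else 0)" for j
  proof (cases "i = j")
    case False
    have "adj E i j * x j = (\<Sum>e\<in>{e \<in> E. i \<in> e \<and> j \<in> e}. x j / (real k - 1))"
      using False E by (simp add: adj_def sum_distrib_right)
    also have "\<dots> = (\<Sum>e\<in>{e \<in> E. i \<in> e}. if j \<in> e - {i} then x j / (real k - 1) else 0)"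
      using False fin(2) by (intro sum.mono_neutral_cong_left) auto
    finally show ?thesis .
  qed (simp add: adj_def)
  hence "(\<Sum>j\<in>V. adj E i j * x j)
     = (\<Sum>e\<in>{e \<in> E. i \<in> e}. \<Sum>j\<in>V. if j \<in> e - {i} then x j / (real k - 1) else 0)"
    by (simp only:) (rule sum.swap)
  also have "\<dots> = (\<Sum>e\<in>{e \<in> E. i \<in> e}. (sum x e - x i) / (real k - 1))"
  proof (intro sum.cong refl)
    fix e assume e: "e \<in> {e \<in> E. i \<in> e}"
    have "(\<Sum>j\<in>V. if j \<in> e - {i} then x j / (real k - 1) else 0) = (\<Sum>j\<in>e - {i}. x j / (real k - 1))"
      using E e fin by (intro sum.mono_neutral_cong_right) auto
    also have "\<dots> = (sum x e - x i) / (real k - 1)"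
    proof -
      have "finite e" using e E fin(1) by (auto intro: finite_subset)
      hence "sum x (e - {i}) = sum x e - x i" using e by (simp add: sum_diff1)
      thus ?thesis by (simp flip: sum_divide_distrib)
    qed
    finally show "(\<Sum>j\<in>V. if j \<in> e - {i} then x j / (real k - 1) else 0) = (sum x e - x i) / (real k - 1)" .
  qed
  finally show ?thesis by (simp add: sum_divide_distrib)
qed

text \<open>The form splits into one term per edge, the sum of products over ordered pairs of
  distinct vertices of that edge. This makes the effect of changing a single edge visible.\<close>

lemma quad_form_uniform:
  assumes fin: "finite V" "finite E" and E: "\<And>e. e \<in> E \<Longrightarrow> e \<subseteq> V \<and> card e = k"
  shows "quad_form V (adj E) x = (\<Sum>e\<in>E. (sum x e)\<^sup>2 - (\<Sum>i\<in>e. (x i)\<^sup>2)) / (real k - 1)"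
proof -
  have "quad_form V (adj E) x = (\<Sum>i\<in>V. x i * (\<Sum>e\<in>{e \<in> E. i \<in> e}. sum x e - x i)) / (real k - 1)"
    using adj_row_uniform[OF fin E] by (simp add: quad_form_altdef flip: sum_divide_distrib)
  also have "(\<Sum>i\<in>V. x i * (\<Sum>e\<in>{e \<in> E. i \<in> e}. sum x e - x i))
     = (\<Sum>i\<in>V. \<Sum>e\<in>E. if i \<in> e then x i * (sum x e - x i) else 0)"
    unfolding sum_distrib_left using fin(2)
    by (intro sum.cong refl sum.mono_neutral_cong_left) auto
  also have "\<dots> = (\<Sum>e\<in>E. \<Sum>i\<in>V. if i \<in> e then x i * (sum x e - x i) else 0)"
    by (rule sum.swap)
  also have "\<dots> = (\<Sum>e\<in>E. (sum x e)\<^sup>2 - (\<Sum>i\<in>e. (x i)\<^sup>2))"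
  proof (intro sum.cong refl)
    fix e assume e: "e \<in> E"
    have "(\<Sum>i\<in>V. if i \<in> e then x i * (sum x e - x i) else 0) = (\<Sum>i\<in>e. x i * (sum x e - x i))"
      using fin(1) E[OF e] by (intro sum.mono_neutral_cong_right) auto
    also have "\<dots> = (\<Sum>i\<in>e. x i * sum x e) - (\<Sum>i\<in>e. (x i)\<^sup>2)"
      by (simp add: right_diff_distrib power2_eq_square sum_subtractf)
    also have "(\<Sum>i\<in>e. x i * sum x e) = (sum x e)\<^sup>2"
      by (simp add: power2_eq_square flip: sum_distrib_right)
    finally show "(\<Sum>i\<in>V. if i \<in> e then x i * (sum x e - x i) else 0) = (sum x e)\<^sup>2 - (\<Sum>i\<in>e. (x i)\<^sup>2)" .
  qed
  finally show ?thesis .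
qed

lemma regrafted_edge:
  assumes "finite V" and e: "e \<subseteq> V \<and> card e = k \<and> p \<in> e" and q: "q \<in> V \<and> q \<notin> e - {p}"
  shows "insert q (e - {p}) \<subseteq> V \<and> card (insert q (e - {p})) = k"
proof -
  have "finite e" using assms finite_subset by blast
  hence "card (insert q (e - {p})) = card e"
    using e q by (metis card_insert_disjoint card.remove finite_Diff)
  thus ?thesis using e q by blast
qed

text \<open>Exchanging \<open>p e\<close> for \<open>q e\<close> affects only the products of this
  vertex with the others of the edge. Injectivity prevents regrafted edges from merging.\<close>

lemma regrafted_quad_form:
  assumes fin: "finite V" "finite E" and E: "\<And>e. e \<in> E \<Longrightarrow> e \<subseteq> V \<and> card e = k \<and> p e \<in> e"
    and q: "\<And>e. e \<in> E \<Longrightarrow> q e \<in> V \<and> q e \<notin> e - {p e}"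
    and inj: "inj_on (\<lambda>e. insert (q e) (e - {p e})) E"
  shows "quad_form V (adj ((\<lambda>e. insert (q e) (e - {p e})) ` E)) x
    = quad_form V (adj E) x + 2 * (\<Sum>e\<in>E. (x (q e) - x (p e)) * sum x (e - {p e})) / (real k - 1)"
proof -
  define g where "g = (\<lambda>e. insert (q e) (e - {p e}))"
  have fe: "finite e" if "e \<in> E" for e using E[OF that] fin(1) finite_subset by blast
  have gE: "e \<subseteq> V \<and> card e = k" if "e \<in> g ` E" for e
    using that regrafted_edge[OF fin(1) E q] by (auto simp: g_def)
  have "(\<Sum>e\<in>g ` E. (sum x e)\<^sup>2 - (\<Sum>i\<in>e. (x i)\<^sup>2))
      = (\<Sum>e\<in>E. (sum x (g e))\<^sup>2 - (\<Sum>i\<in>g e. (x i)\<^sup>2))"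
    using inj by (simp add: sum.reindex g_def)
  also have "\<dots> = (\<Sum>e\<in>E. (sum x e)\<^sup>2 - (\<Sum>i\<in>e. (x i)\<^sup>2) + 2 * ((x (q e) - x (p e)) * sum x (e - {p e})))"
  proof (intro sum.cong refl)
    fix e assume e: "e \<in> E"
    have "sum h (g e) = h (q e) + sum h (e - {p e})" for h :: "'a \<Rightarrow> real"
      unfolding g_def using q[OF e] fe[OF e] by (intro sum.insert) auto
    moreover have "sum h e = h (p e) + sum h (e - {p e})" for h :: "'a \<Rightarrow> real"
      using E[OF e] fe[OF e] by (intro sum.remove) auto
    ultimately show "(sum x (g e))\<^sup>2 - (\<Sum>i\<in>g e. (x i)\<^sup>2)
      = (sum x e)\<^sup>2 - (\<Sum>i\<in>e. (x i)\<^sup>2) + 2 * ((x (q e) - x (p e)) * sum x (e - {p e}))"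
      by (simp add: power2_eq_square algebra_simps)
  qed
  also have "\<dots> = (\<Sum>e\<in>E. (sum x e)\<^sup>2 - (\<Sum>i\<in>e. (x i)\<^sup>2)) + 2 * (\<Sum>e\<in>E. (x (q e) - x (p e)) * sum x (e - {p e}))"
    by (simp add: sum.distrib sum_distrib_left)
  finally have *: "(\<Sum>e\<in>g ` E. (sum x e)\<^sup>2 - (\<Sum>i\<in>e. (x i)\<^sup>2)) = \<dots>" .
  have "quad_form V (adj (g ` E)) x = (\<Sum>e\<in>g ` E. (sum x e)\<^sup>2 - (\<Sum>i\<in>e. (x i)\<^sup>2)) / (real k - 1)"
    using fin gE by (intro quad_form_uniform) auto
  moreover have "quad_form V (adj E) x = (\<Sum>e\<in>E. (sum x e)\<^sup>2 - (\<Sum>i\<in>e. (x i)\<^sup>2)) / (real k - 1)"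
    using fin E by (intro quad_form_uniform) auto
  ultimately show ?thesis unfolding g_def[symmetric] by (simp add: * add_divide_distrib)
qed

text \<open>As \<open>u\<close> is never a child, a regrafted edge contains \<open>u\<close> only if
  its new parent is \<open>u\<close>. The choice \<open>q = p\<close> also yields the row of the
  original hypergraph.\<close>

lemma regrafted_row:
  assumes fin: "finite V" "finite E" and E: "\<And>e. e \<in> E \<Longrightarrow> e \<subseteq> V \<and> card e = k \<and> p e \<in> e"
    and q: "\<And>e. e \<in> E \<Longrightarrow> q e \<in> V \<and> q e \<notin> e - {p e}"
    and inj: "inj_on (\<lambda>e. insert (q e) (e - {p e})) E"
    and u: "\<And>e. e \<in> E \<Longrightarrow> u \<notin> e - {p e}"
  shows "(\<Sum>j\<in>V. adj ((\<lambda>e. insert (q e) (e - {p e})) ` E) u j * x j)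
    = (\<Sum>e\<in>{e \<in> E. q e = u}. sum x (e - {p e})) / (real k - 1)"
proof -
  define g where "g = (\<lambda>e. insert (q e) (e - {p e}))"
  have fe: "finite e" if "e \<in> E" for e using E[OF that] fin(1) finite_subset by blast
  have gE: "e \<subseteq> V \<and> card e = k" if "e \<in> g ` E" for e
    using that regrafted_edge[OF fin(1) E q] by (auto simp: g_def)
  have "{e \<in> g ` E. u \<in> e} = g ` {e \<in> E. q e = u}" using u by (auto simp: g_def)
  moreover have "inj_on g {e \<in> E. q e = u}" using inj by (auto simp: g_def inj_on_def)
  moreover have "sum x (g e) - x u = sum x (e - {p e})" if "e \<in> {e \<in> E. q e = u}" for e
    using that q fe by (auto simp: g_def)
  ultimately have "(\<Sum>e\<in>{e \<in> g ` E. u \<in> e}. sum x e - x u) = (\<Sum>e\<in>{e \<in> E. q e = u}. sum x (e - {p e}))"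
    by (simp add: sum.reindex)
  moreover have "(\<Sum>j\<in>V. adj (g ` E) u j * x j) = (\<Sum>e\<in>{e \<in> g ` E. u \<in> e}. sum x e - x u) / (real k - 1)"
    using fin gE by (intro adj_row_uniform) auto
  ultimately show ?thesis by (simp add: g_def)
qed

section \<open>Extremality of the double hyperstar\<close>

theorem theorem1p2:
  fixes V :: "'a set" and E :: "'a set set" and k n :: nat
  assumes "3 \<le> k"
    and "supertree V E"
    and "k_uniform k E"
    and "card V = n"
    and "3 \<le> card E"
    and "\<not> hg_iso V E (superstar_V n) (superstar_E n k)"
  shows "spectral_radius V E
           \<le> spectral_radius (dstar_V k ((n - 1) div (k - 1) - 2) 1) (dstar_E k ((n - 1) div (k - 1) - 2) 1)
         \<and> (spectral_radius V E
              = spectral_radius (dstar_V k ((n - 1) div (k - 1) - 2) 1) (dstar_E k ((n - 1) div (k - 1) - 2) 1)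
            \<longleftrightarrow> hg_iso V E (dstar_V k ((n - 1) div (k - 1) - 2) 1) (dstar_E k ((n - 1) div (k - 1) - 2) 1))"
proof -
  have hg: "hypergraph V E" and con: "hg_connected V E" using assms(2) by (auto simp: supertree_def)
  have fin: "finite V" and ne: "V \<noteq> {}" and EV: "\<And>e. e \<in> E \<Longrightarrow> e \<subseteq> V"
    using hg by (auto simp: hypergraph_def)
  have ck: "\<And>e. e \<in> E \<Longrightarrow> card e = k" using assms(3) by (auto simp: k_uniform_def)
  have finE: "finite E" using assms(5) by (metis card.infinite not_numeral_le_zero)
  obtain x where x0: "\<And>i. x i \<ge> 0" and x1: "(\<Sum>i\<in>V. (x i)\<^sup>2) = 1"
    and qx: "quad_form V (adj E) x = spectral_radius V E"
    and bound: "\<And>y. quad_form V (adj E) y \<le> spectral_radius V E * (\<Sum>i\<in>V. (y i)\<^sup>2)"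
    using spectral_radius_rayleigh[OF hg] by metis
  have eig: "(\<Sum>j\<in>V. adj E i j * x j) = spectral_radius V E * x i" if "i \<in> V" for i
    using quad_form_max_eigenvector[OF fin adj_commute bound, of x] qx x1 that by simp
  have xpos: "x i > 0" if "i \<in> V" for i
  proof (rule eigenvector_connected_pos[OF hg finE con x0 _ eig that])
    show "\<exists>i\<in>V. x i \<noteq> 0"
    proof (rule ccontr)
      assume "\<not> ?thesis"
      hence "(\<Sum>i\<in>V. (x i)\<^sup>2) = 0" by simp
      thus False using x1 by simp
    qed
  qed
  have "Max (x ` V) \<in> x ` V" using fin ne by (intro Max_in) auto
  then obtain u where u: "u \<in> V" "x u = Max (x ` V)" by force
  have xu: "x i \<le> x u" if "i \<in> V" for i unfolding u(2) using fin that by (intro Max_ge) auto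
  obtain p where p: "rooted_at u V E p" using supertree_rooted[OF assms(2) u(1)] .
  have pe: "p e \<in> e" if "e \<in> E" for e using p that by (simp add: rooted_at_def)
  have disj: "(e - {p e}) \<inter> (e' - {p e'}) = {}" if "e \<in> E" "e' \<in> E" "e \<noteq> e'" for e e'
    using p that by (simp add: rooted_at_def)
  have part: "V - {u} = (\<Union>e\<in>E. e - {p e})" using p by (simp add: rooted_at_def)
  have uc: "u \<notin> e - {p e}" if "e \<in> E" for e using part that by blast
  have cc: "card (e - {p e}) = k - 1" if "e \<in> E" for e
    using ck[OF that] pe[OF that] by (simp add: card_Diff_singleton)
  define m where "m = card E"
  have m3: "m \<ge> 3" using assms(5) by (simp add: m_def)
  \<comment> \<open>Any enumeration of the edges presents the child sets as the blocks that the
    recognition lemmas expect. It is applied to an arbitrary order for the superstar and to a chosen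
    one for the double hyperstar.\<close>
  have blocks: "\<And>i. i < m \<Longrightarrow> card (ys ! i - {p (ys ! i)}) = k - 1"
      "\<And>i j. i < m \<Longrightarrow> j < m \<Longrightarrow> i \<noteq> j \<Longrightarrow> (ys ! i - {p (ys ! i)}) \<inter> (ys ! j - {p (ys ! j)}) = {}"
      "\<And>i. i < m \<Longrightarrow> u \<notin> ys ! i - {p (ys ! i)}"
      "V = insert u (\<Union>i<m. ys ! i - {p (ys ! i)})"
    if ys: "distinct ys" "set ys = E" for ys
  proof -
    have len: "length ys = m" using ys by (metis distinct_card m_def)
    have inE: "ys ! i \<in> E" if "i < m" for i using ys len that nth_mem by metis
    show "card (ys ! i - {p (ys ! i)}) = k - 1" if "i < m" for i using cc[OF inE[OF that]] .
    show "(ys ! i - {p (ys ! i)}) \<inter> (ys ! j - {p (ys ! j)}) = {}" if "i < m" "j < m" "i \<noteq> j" for i j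
      using disj[OF inE inE] that ys(1) len by (simp add: nth_eq_iff_index_eq)
    show "u \<notin> ys ! i - {p (ys ! i)}" if "i < m" for i using uc[OF inE[OF that]] .
    have "(\<Union>i<m. ys ! i - {p (ys ! i)}) = (\<Union>e\<in>E. e - {p e})"
      unfolding ys(2)[symmetric] set_conv_nth len by auto
    thus "V = insert u (\<Union>i<m. ys ! i - {p (ys ! i)})" using part u(1) by auto
  qed
  have image_nth: "(\<lambda>i. h (ys ! i)) ` {..<m} = h ` E" if "distinct ys" "set ys = E"
    for ys and h :: "'a set \<Rightarrow> 'a set"
  proof -
    have "length ys = m" using that by (metis distinct_card m_def)
    thus ?thesis unfolding that(2)[symmetric] set_conv_nth by auto
  qed
  \<comment> \<open>Counting the child sets gives \<open>n - 1 = m * (k - 1)\<close>, so the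
    quotient in the statement is the number of edges.\<close>
  have "card (\<Union>e\<in>E. e - {p e}) = (\<Sum>e\<in>E. card (e - {p e}))"
    using finE disj finite_subset[OF EV fin] by (intro card_UN_disjoint) auto
  also have "\<dots> = m * (k - 1)" using cc by (simp add: m_def)
  finally have "card (V - {u}) = m * (k - 1)" using part by simp
  hence n: "n = 1 + m * (k - 1)"
    using assms(4) u(1) fin card_Suc_Diff1[OF fin u(1)] by simp
  have not_star: "\<not> (\<forall>e\<in>E. p e = u)"
  proof
    assume *: "\<forall>e\<in>E. p e = u"
    obtain ys where ys: "distinct ys" "set ys = E" using finite_distinct_list[OF finE] by blast
    have "hg_iso V ((\<lambda>i. insert u (ys ! i - {p (ys ! i)})) ` {..<m}) (superstar_V (1 + m * (k - 1)))
        (superstar_E (1 + m * (k - 1)) k)"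
      using superstar_iso[OF _ _ blocks[OF ys]] assms(1) m3 by simp
    also have "(\<lambda>i. insert u (ys ! i - {p (ys ! i)})) ` {..<m} = (\<lambda>e. insert u (e - {p e})) ` E"
      by (rule image_nth[OF ys])
    also have "\<dots> = (\<lambda>e. e) ` E" using * pe by (intro image_cong refl) auto
    finally show False using assms(6) n by simp
  qed
  then obtain e0 f where e0: "e0 \<in> E" "p e0 \<noteq> u" and f: "f \<in> E" "p f = u" "p e0 \<in> f"
    using p unfolding rooted_at_def by blast
  define v where "v = p e0"
  have v: "v \<in> f - {p f}" "v \<in> V" "v \<noteq> u" using e0 f EV[OF f(1)] by (auto simp: v_def)
  have fe0: "f \<noteq> e0" using e0 f by auto
  \<comment> \<open>The new parents: \<open>e0\<close> keeps its parent \<open>v\<close>, a child in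
    \<open>f\<close>, and all other edges hang at \<open>u\<close>. Thus \<open>f\<close> becomes
    the central edge and \<open>e0\<close> the single pendant edge at \<open>v\<close>.\<close>
  define q where "q = (\<lambda>e. if e = e0 then v else u)"
  define g where "g = (\<lambda>e. insert (q e) (e - {p e}))"
  define l where "l = m - 2"
  have l: "(n - 1) div (k - 1) - 2 = l" "m = l + 2" using n assms(1) m3 by (auto simp: l_def)
  have qV: "q e \<in> V \<and> q e \<notin> e - {p e}" if "e \<in> E" for e
    using that u v uc by (auto simp: q_def v_def)
  \<comment> \<open>Equal regrafted edges with disjoint child sets would leave at most one child in
    \<open>a\<close>, while \<open>3 \<le> k\<close> gives at least two.\<close>
  have injg: "inj_on g E"
  proof (rule inj_onI, rule ccontr)
    fix a b assume ab: "a \<in> E" "b \<in> E" "g a = g b" "a \<noteq> b"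
    hence "a - {p a} \<subseteq> {q b}" using disj[OF ab(1,2,4)] by (auto simp: g_def)
    hence "card (a - {p a}) \<le> 1" using card_mono[of "{q b}" "a - {p a}"] by simp
    thus False using cc[OF ab(1)] assms(1) by simp
  qed
  obtain xs where xs: "distinct xs" "set xs = E - {f, e0}" using finite_distinct_list finE by (metis finite_Diff)
  \<comment> \<open>The order fits \<open>dstar_iso\<close>: \<open>f\<close> first, so that
    \<open>v\<close> lies in block 0, and \<open>e0\<close> last, at index
    \<open>l + 1\<close>.\<close>
  define ys where "ys = f # xs @ [e0]"
  have ys: "distinct ys" "set ys = E" using xs f e0 fe0 by (auto simp: ys_def)
  have len: "length ys = m" using ys by (metis distinct_card m_def)
  have ysl: "ys ! i = e0 \<longleftrightarrow> i = l + 1" if "i < m" for i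
  proof -
    have "ys ! (l + 1) = e0" using len l by (simp add: ys_def nth_append)
    thus ?thesis using ys(1) len l that by (metis nth_eq_iff_index_eq add_less_cancel_left one_less_numeral_iff semiring_norm(76))
  qed
  have "hg_iso V ((\<lambda>i. insert (if i = l + 1 then v else u) (ys ! i - {p (ys ! i)})) ` {..<m})
      (dstar_V k l 1) (dstar_E k l 1)"
    using assms(1) l(2) v(1) by (intro dstar_iso[OF _ _ blocks(1-3)[OF ys] _ blocks(4)[OF ys]]) (auto simp: ys_def)
  also have "(\<lambda>i. insert (if i = l + 1 then v else u) (ys ! i - {p (ys ! i)})) ` {..<m} = (\<lambda>i. g (ys ! i)) ` {..<m}"
    unfolding g_def q_def using ysl by (intro image_cong) auto
  also have "\<dots> = g ` E" by (rule image_nth[OF ys])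
  finally have iso: "hg_iso V (g ` E) (dstar_V k l 1) (dstar_E k l 1)" .
  have Ep: "e \<subseteq> V \<and> card e = k \<and> p e \<in> e" if "e \<in> E" for e using that EV ck pe by blast
  have hg': "hypergraph V (g ` E)"
    unfolding hypergraph_def
  proof (intro conjI ballI)
    fix e assume "e \<in> g ` E"
    hence "e \<subseteq> V \<and> card e = k" using regrafted_edge[OF fin Ep qV] by (auto simp: g_def)
    thus "e \<subseteq> V" "2 \<le> card e" using assms(1) by auto
  qed (use fin ne in auto)
  define \<rho> where "\<rho> = spectral_radius V (g ` E)"
  have \<rho>: "spectral_radius (dstar_V k l 1) (dstar_E k l 1) = \<rho>"
    unfolding \<rho>_def using hg' by (intro hg_iso_spectral_radius[symmetric] iso) (auto simp: hypergraph_def)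
  have bound': "quad_form V (adj (g ` E)) y \<le> \<rho> * (\<Sum>i\<in>V. (y i)\<^sup>2)" for y
    using spectral_radius_rayleigh[OF hg'] unfolding \<rho>_def by metis
  have spos: "sum x (e - {p e}) > 0" if "e \<in> E" for e
  proof -
    have "card (e - {p e}) > 0" using cc[OF that] assms(1) by simp
    hence "finite (e - {p e})" "e - {p e} \<noteq> {}" by (simp_all add: card_gt_0_iff)
    thus ?thesis using EV[OF that] xpos by (intro sum_pos) auto
  qed
  \<comment> \<open>The edge \<open>e0\<close> contributes 0, and every other edge gains since
    \<open>x u\<close> is maximal.\<close>
  have "(\<Sum>e\<in>E. (x (q e) - x (p e)) * sum x (e - {p e})) \<ge> 0"
  proof (rule sum_nonneg, rule mult_nonneg_nonneg)
    fix e assume e: "e \<in> E"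
    show "sum x (e - {p e}) \<ge> 0" using spos[OF e] by simp
    show "x (q e) - x (p e) \<ge> 0" using xu[of "p e"] Ep[OF e] by (auto simp: q_def v_def)
  qed
  hence ge: "spectral_radius V E \<le> quad_form V (adj (g ` E)) x"
    using regrafted_quad_form[OF fin finE Ep qV injg[unfolded g_def], of x, folded g_def] qx assms(1)
    by simp
  hence le: "spectral_radius V E \<le> \<rho>" using bound'[of x] x1 by simp
  have "hg_iso V E (dstar_V k l 1) (dstar_E k l 1)" if eq: "spectral_radius V E = \<rho>"
  proof -
    \<comment> \<open>Equality squeezes the form at \<open>x\<close> to its maximum for the
      regrafted hypergraph, so \<open>x\<close> is an eigenvector there too, with the same
      eigenvalue.\<close>
    have "quad_form V (adj (g ` E)) x = \<rho> * (\<Sum>i\<in>V. (x i)\<^sup>2)"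
      using ge bound'[of x] x1 eq by simp
    from quad_form_max_eigenvector[OF fin adj_commute bound' this u(1)]
    have "(\<Sum>j\<in>V. adj (g ` E) u j * x j) = (\<Sum>j\<in>V. adj E u j * x j)" using eig[OF u(1)] eq by simp
    moreover have "(\<Sum>j\<in>V. adj (g ` E) u j * x j) = (\<Sum>e\<in>{e \<in> E. q e = u}. sum x (e - {p e})) / (real k - 1)"
      unfolding g_def by (rule regrafted_row[OF fin finE Ep qV injg[unfolded g_def] uc])
    moreover have "(\<Sum>j\<in>V. adj E u j * x j) = (\<Sum>e\<in>{e \<in> E. p e = u}. sum x (e - {p e})) / (real k - 1)"
    proof -
      have id: "(\<lambda>e. insert (p e) (e - {p e})) ` E = E" "inj_on (\<lambda>e. insert (p e) (e - {p e})) E"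
        using pe by (auto simp: insert_absorb inj_on_def)
      have "p e \<in> V \<and> p e \<notin> e - {p e}" if "e \<in> E" for e using Ep[OF that] by auto
      from regrafted_row[OF fin finE Ep this id(2) uc, of x] show ?thesis unfolding id(1) .
    qed
    ultimately have sums: "(\<Sum>e\<in>{e \<in> E. q e = u}. sum x (e - {p e})) = (\<Sum>e\<in>{e \<in> E. p e = u}. sum x (e - {p e}))"
      using assms(1) by simp
    \<comment> \<open>\<open>D\<close> consists of the edges that were moved. The equal rows at
      \<open>u\<close> make their child sums add up to 0, but each such sum is positive, so
      \<open>D\<close> is empty.\<close>
    define D where "D = {e \<in> E. q e = u} - {e \<in> E. p e = u}"
    have "{e \<in> E. p e = u} \<subseteq> {e \<in> E. q e = u}" using e0 by (auto simp: q_def)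
    from sum.subset_diff[OF this, of "\<lambda>e. sum x (e - {p e})"] finE sums
    have "(\<Sum>e\<in>D. sum x (e - {p e})) = 0" by (simp add: D_def)
    moreover have "finite D" using finE by (simp add: D_def)
    ultimately have "D = {}" using spos sum_pos[of D "\<lambda>e. sum x (e - {p e})"] by (fastforce simp: D_def)
    hence "q e = p e" if "e \<in> E" for e using that by (auto simp: D_def q_def v_def split: if_splits)
    hence "g ` E = (\<lambda>e. e) ` E" using pe by (intro image_cong) (auto simp: g_def)
    thus ?thesis using iso by simp
  qed
  moreover have "spectral_radius V E = \<rho>" if "hg_iso V E (dstar_V k l 1) (dstar_E k l 1)"
    using hg_iso_spectral_radius[OF EV that] \<rho> by simp
  ultimately show ?thesis unfolding l(1) \<rho> using le by blast
qed

end
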